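(* Let $r$ be a positive integer, $R=\lfloor r/2\rfloor$, let $n\ge 2R^2+2R+1$ be an integer and let $D=\{a_1,\ldots,a_\mu\}$ be a $B_2$-sequence over $\mathbb{Z}_n$. Let $f(i,j)\equiv iR+j(R+1)\pmod n$, and define the array $\mathcal{A}$ on $\mathbb{Z}^2$ by placing a dot at $(i,j)$ if and only if $f(i,j)\in D$. Then $\mathcal{A}$ is doubly periodic with period $(n,n)$ and density $\mu/n$, and the dots contained in any Lee sphere of radius $R$ form a DDC.
   Context: For an abelian group $A$, a sequence of $\mu$ distinct elements $a_1,\ldots,a_\mu$ of $A$ is a $B_2$-sequence over $A$ if all sums $a_{i_1}+a_{i_2}$ with $1\le i_1\le i_2\le\mu$ are distinct. Points $(i,j)\in\mathbb{Z}^2$ are in column $i$ and row $j$. An array of dots on $\mathbb{Z}^2$ is doubly periodic with period $(\eta,\kappa)$ if $(i,j)$ is a dot iff $(i+\eta,j)$ is a dot iff $(i,j+\kappa)$ is a dot, for all $i,j$; its density is $d/(\eta\kappa)$, where $d$ is the number of dots in any set $\{(i_0+i,j_0+j):0\le i\le\eta-1,0\le j\le\kappa-1\}$. A Lee sphere of radius $R$ is the set of points of $\mathbb{Z}^2$ at Manhattan distance ($|\Delta i|+|\Delta j|$) at most $R$ from a centre point of $\mathbb{Z}^2$. A set of dots is a DDC if the vectors $x-y$, over ordered pairs $(x,y)$ of distinct dots, are pairwise distinct. *)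

theory Defs
  imports Complex_Main "HOL-Algebra.Elementary_Groups" "HOL-Library.Product_Plus"
begin

definition B2_sequence :: "('a, 'b) monoid_scheme \<Rightarrow> nat \<Rightarrow> (nat \<Rightarrow> 'a) \<Rightarrow> bool" where
  "B2_sequence G \<mu> a \<longleftrightarrow>
     comm_group G \<and>
     (\<forall>i\<in>{1..\<mu>}. a i \<in> carrier G) \<and>
     inj_on a {1..\<mu>} \<and>
     inj_on (\<lambda>(i\<^sub>1, i\<^sub>2). a i\<^sub>1 \<otimes>\<^bsub>G\<^esub> a i\<^sub>2) {(i\<^sub>1, i\<^sub>2). 1 \<le> i\<^sub>1 \<and> i\<^sub>1 \<le> i\<^sub>2 \<and> i\<^sub>2 \<le> \<mu>}"

text \<open>An array of dots on the integer grid is the set of positions of its dots, where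
  \<open>(i, j)\<close> is the point in column \<open>i\<close> and row \<open>j\<close>.\<close>

definition doubly_periodic :: "(int \<times> int) set \<Rightarrow> nat \<Rightarrow> nat \<Rightarrow> bool" where
  "doubly_periodic A \<eta> \<kappa> \<longleftrightarrow>
     (\<forall>i j. ((i, j) \<in> A \<longleftrightarrow> (i + int \<eta>, j) \<in> A) \<and> ((i, j) \<in> A \<longleftrightarrow> (i, j + int \<kappa>) \<in> A))"

definition window :: "int \<Rightarrow> int \<Rightarrow> nat \<Rightarrow> nat \<Rightarrow> (int \<times> int) set" where
  "window i\<^sub>0 j\<^sub>0 \<eta> \<kappa> =
     {(i\<^sub>0 + i, j\<^sub>0 + j) | i j. 0 \<le> i \<and> i \<le> int \<eta> - 1 \<and> 0 \<le> j \<and> j \<le> int \<kappa> - 1}"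

text \<open>The dot count is required to give the same value \<open>\<delta>\<close> for every position of the
  window, so the density does not depend on a choice of window.\<close>

definition has_density :: "(int \<times> int) set \<Rightarrow> nat \<Rightarrow> nat \<Rightarrow> real \<Rightarrow> bool" where
  "has_density A \<eta> \<kappa> \<delta> \<longleftrightarrow>
     (\<forall>i\<^sub>0 j\<^sub>0. real (card (A \<inter> window i\<^sub>0 j\<^sub>0 \<eta> \<kappa>)) / (real \<eta> * real \<kappa>) = \<delta>)"

definition lee_sphere :: "int \<times> int \<Rightarrow> nat \<Rightarrow> (int \<times> int) set" where
  "lee_sphere c R = {(i, j). \<bar>i - fst c\<bar> + \<bar>j - snd c\<bar> \<le> int R}"

definition DDC :: "(int \<times> int) set \<Rightarrow> bool" where
  "DDC S \<longleftrightarrow> inj_on (\<lambda>(x, y). x - y) {(x, y). x \<in> S \<and> y \<in> S \<and> x \<noteq> y}"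

text \<open>Elements of \<open>\<int>\<^sub>n\<close> are represented by the least nonnegative residues, the carrier
  of \<^const>\<open>integer_mod_group\<close>.\<close>

definition fold_map :: "nat \<Rightarrow> nat \<Rightarrow> int \<Rightarrow> int \<Rightarrow> int" where
  "fold_map n R i j = (i * int R + j * (int R + 1)) mod int n"

definition fold_array :: "nat \<Rightarrow> nat \<Rightarrow> int set \<Rightarrow> (int \<times> int) set" where
  "fold_array n R D = {(i, j). fold_map n R i j \<in> D}"

end

theory Submission
  imports Defs
begin

text \<open>Put \<open>s = i + j\<close>, so that \<open>f(i, j) = s R + j\<close>. The map \<open>(i, j) \<mapsto> (f(i, j), s)\<close> is
  unimodular, hence maps every \<open>n \<times> n\<close> window bijectively onto \<open>\<int>\<^sub>n \<times> \<int>\<^sub>n\<close>; this gives the density.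
  If two points of a Lee sphere of radius \<open>R\<close> have the same image under \<open>f\<close>, their difference
  \<open>(u, v)\<close> satisfies \<open>\<bar>u\<bar> + \<bar>v\<bar> \<le> 2R\<close>, so \<open>\<bar>u R + v (R + 1)\<bar> \<le> 2R(R + 1) < n\<close> and the congruence is an
  equation, which forces \<open>(u, v)\<close> to be a multiple of \<open>(R + 1, -R)\<close> and hence zero. So \<open>f\<close> is
  injective on the sphere, and equal difference vectors of dots become equal sums of two elements of
  \<open>D\<close>.\<close>

lemma doubly_periodic_fold_array: "doubly_periodic (fold_array n R D) n n"
proof -
  have "fold_map n R (i + int n) j = fold_map n R i j" for i j
  proof -
    have "(i + int n) * int R + j * (int R + 1) = i * int R + j * (int R + 1) + int n * int R"
      by (simp add: algebra_simps)
    then show ?thesis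
      by (simp only: fold_map_def mod_mult_self2)
  qed
  moreover have "fold_map n R i (j + int n) = fold_map n R i j" for i j
  proof -
    have "i * int R + (j + int n) * (int R + 1) = i * int R + j * (int R + 1) + int n * (int R + 1)"
      by (simp add: algebra_simps)
    then show ?thesis
      by (simp only: fold_map_def mod_mult_self2)
  qed
  ultimately show ?thesis
    by (simp add: doubly_periodic_def fold_array_def)
qed

lemma window_eq_Times: "window i\<^sub>0 j\<^sub>0 \<eta> \<kappa> = {i\<^sub>0..<i\<^sub>0 + int \<eta>} \<times> {j\<^sub>0..<j\<^sub>0 + int \<kappa>}"
proof (intro equalityI subsetI)
  fix p assume "p \<in> {i\<^sub>0..<i\<^sub>0 + int \<eta>} \<times> {j\<^sub>0..<j\<^sub>0 + int \<kappa>}"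
  then have "p = (i\<^sub>0 + (fst p - i\<^sub>0), j\<^sub>0 + (snd p - j\<^sub>0)) \<and> 0 \<le> fst p - i\<^sub>0 \<and> fst p - i\<^sub>0 \<le> int \<eta> - 1
      \<and> 0 \<le> snd p - j\<^sub>0 \<and> snd p - j\<^sub>0 \<le> int \<kappa> - 1"
    by auto
  then show "p \<in> window i\<^sub>0 j\<^sub>0 \<eta> \<kappa>"
    unfolding window_def by blast
qed (auto simp: window_def)

lemma eq_if_dvd_diff_small:
  fixes x y n :: int
  assumes "n dvd x - y" and "\<bar>x - y\<bar> < n"
  shows "x = y"
  using assms dvd_imp_le_int[of "x - y" n] by auto

lemma bij_betw_window_fold_map:
  assumes "n > 0"
  shows "bij_betw (\<lambda>(i, j). (fold_map n R i j, (i + j) mod int n)) (window i\<^sub>0 j\<^sub>0 n n)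
    ({0..<int n} \<times> {0..<int n})"
proof -
  let ?g = "\<lambda>(i, j). (fold_map n R i j, (i + j) mod int n)"
  let ?W = "window i\<^sub>0 j\<^sub>0 n n" and ?Z = "{0..<int n} \<times> {0..<int n}"
  have inj: "inj_on ?g ?W"
  proof (rule inj_onI)
    fix p q assume p: "p \<in> ?W" and q: "q \<in> ?W" and eq: "?g p = ?g q"
    obtain i j k l where pq: "p = (i, j)" "q = (k, l)"
      by (cases p, cases q)
    have s: "int n dvd (i + j) - (k + l)"
      using eq by (simp add: pq mod_eq_dvd_iff)
    have f: "int n dvd (i * int R + j * (int R + 1)) - (k * int R + l * (int R + 1))"
      using eq by (simp add: pq fold_map_def mod_eq_dvd_iff)
    \<comment> \<open>The inverse of the unimodular map, read modulo \<open>n\<close>: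
      \<open>j\<close> is \<open>f - R s\<close>, and then \<open>i\<close> is
      \<open>s - j\<close>.\<close>
    have "j - l = ((i * int R + j * (int R + 1)) - (k * int R + l * (int R + 1)))
        - int R * ((i + j) - (k + l))"
      by (simp add: algebra_simps)
    then have "int n dvd j - l"
      using s f by (metis dvd_diff dvd_mult)
    then have "j = l"
      by (rule eq_if_dvd_diff_small) (use p q in \<open>auto simp: pq window_eq_Times\<close>)
    have "int n dvd i - k"
      using s \<open>j = l\<close> by simp
    then have "i = k"
      by (rule eq_if_dvd_diff_small) (use p q in \<open>auto simp: pq window_eq_Times\<close>)
    with \<open>j = l\<close> show "p = q"
      by (simp add: pq)
  qed
  \<comment> \<open>Surjectivity follows by counting: window and target both have
    \<open>n * n\<close> elements.\<close>
  moreover have "?g ` ?W = ?Z"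
  proof (rule card_subset_eq)
    show "?g ` ?W \<subseteq> ?Z"
      using assms by (auto simp: fold_map_def)
    show "card (?g ` ?W) = card ?Z"
      using card_image[OF inj] by (simp add: window_eq_Times card_cartesian_product)
  qed simp
  ultimately show ?thesis
    by (simp add: bij_betw_def)
qed

text \<open>Under the bijection the first coordinate alone decides whether a point is a dot and the
  second is free, so the dots of any window correspond to \<open>D \<times> {0..<int n}\<close> and
  number \<open>card D * n\<close>.\<close>

lemma has_density_fold_array:
  assumes "n > 0" and "D \<subseteq> {0..<int n}"
  shows "has_density (fold_array n R D) n n (real (card D) / real n)"
  unfolding has_density_def
proof (intro allI)
  fix i\<^sub>0 j\<^sub>0
  let ?g = "\<lambda>(i, j). (fold_map n R i j, (i + j) mod int n)"
  let ?W = "window i\<^sub>0 j\<^sub>0 n n"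
  have bij: "bij_betw ?g ?W ({0..<int n} \<times> {0..<int n})"
    using assms(1) by (rule bij_betw_window_fold_map)
  have "?g ` (fold_array n R D \<inter> ?W) = D \<times> {0..<int n}"
  proof (intro equalityI subsetI)
    fix z assume z: "z \<in> D \<times> {0..<int n}"
    then have "z \<in> ?g ` ?W"
      using bij assms(2) by (auto simp: bij_betw_def)
    then obtain p where "p \<in> ?W" "z = ?g p"
      by blast
    with z show "z \<in> ?g ` (fold_array n R D \<inter> ?W)"
      by (intro image_eqI[of _ _ p]) (auto simp: fold_array_def)
  qed (use assms(1) in \<open>auto simp: fold_array_def\<close>)
  moreover have "inj_on ?g (fold_array n R D \<inter> ?W)"
    using bij by (auto simp: bij_betw_def intro: inj_on_subset)
  ultimately have "card (fold_array n R D \<inter> ?W) = card D * n"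
    using card_image[of ?g "fold_array n R D \<inter> ?W"] by (simp add: card_cartesian_product)
  then show "real (card (fold_array n R D \<inter> ?W)) / (real n * real n) = real (card D) / real n"
    using assms(1) by simp
qed

lemma inj_on_fold_map_lee_sphere:
  assumes "n \<ge> 2 * R\<^sup>2 + 2 * R + 1"
  shows "inj_on (\<lambda>(i, j). fold_map n R i j) (lee_sphere c R)"
proof (rule inj_onI)
  fix p q
  assume p: "p \<in> lee_sphere c R" and q: "q \<in> lee_sphere c R"
    and eq: "(\<lambda>(i, j). fold_map n R i j) p = (\<lambda>(i, j). fold_map n R i j) q"
  obtain i j k l where pq: "p = (i, j)" "q = (k, l)"
    by (cases p, cases q)
  define u v where "u = i - k" and "v = j - l"
  have uv: "\<bar>u\<bar> + \<bar>v\<bar> \<le> 2 * int R"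
    using p q by (auto simp: pq lee_sphere_def u_def v_def)
  have "int n dvd (i * int R + j * (int R + 1)) - (k * int R + l * (int R + 1))"
    using eq by (simp add: pq fold_map_def mod_eq_dvd_iff)
  \<comment> \<open>The \<open>- 0\<close> supplies the shape \<open>x - y\<close> of
    \<open>eq_if_dvd_diff_small\<close>, with \<open>y = 0\<close>.\<close>
  then have dvd: "int n dvd u * int R + v * (int R + 1) - 0"
    by (simp add: u_def v_def algebra_simps)
  have "\<bar>u * int R + v * (int R + 1)\<bar> \<le> \<bar>u\<bar> * int R + \<bar>v\<bar> * (int R + 1)"
    by (rule order_trans[OF abs_triangle_ineq]) (simp add: abs_mult)
  also have "\<dots> \<le> (\<bar>u\<bar> + \<bar>v\<bar>) * (int R + 1)"
    by (simp add: algebra_simps)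
  also have "\<dots> \<le> 2 * int R * (int R + 1)"
    using uv by (intro mult_right_mono) auto
  \<comment> \<open>The bound on \<open>n\<close> is calibrated here: \<open>2 * R * (R + 1)\<close>
    is exactly one less than the smallest admissible \<open>n\<close>.\<close>
  also have "\<dots> < int (2 * R\<^sup>2 + 2 * R + 1)"
    by (simp add: power2_eq_square algebra_simps)
  also have "\<dots> \<le> int n"
    using assms by (simp only: of_nat_le_iff)
  finally have "u * int R + v * (int R + 1) = 0"
    using dvd by (intro eq_if_dvd_diff_small) auto
  \<comment> \<open>The coordinates of \<open>(R + 1, -R)\<close> add up to 1, so the multiplier is
    \<open>u + v\<close>.\<close>
  then have v: "v = - ((u + v) * int R)" and u: "u = (u + v) * (int R + 1)"
    by (simp_all add: algebra_simps)
  \<comment> \<open>A nonzero multiple of \<open>(R + 1, -R)\<close> has Manhattan length at least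
    \<open>2 * R + 1\<close>, just above the diameter of the sphere.\<close>
  have "\<bar>u + v\<bar> * (2 * int R + 1) = \<bar>(u + v) * (int R + 1)\<bar> + \<bar>- ((u + v) * int R)\<bar>"
    by (simp only: abs_minus_cancel abs_mult) (simp add: algebra_simps)
  also have "\<dots> = \<bar>u\<bar> + \<bar>v\<bar>"
    using u v by metis
  also have "\<dots> < 1 * (2 * int R + 1)"
    using uv by simp
  finally have "\<bar>u + v\<bar> < 1"
    by (rule mult_right_less_imp_less) simp
  then have "u + v = 0"
    by simp
  have "u = 0"
    using u unfolding \<open>u + v = 0\<close> by simp
  moreover have "v = 0"
    using v unfolding \<open>u + v = 0\<close> by simp
  ultimately show "p = q"
    by (simp add: pq u_def v_def)
qed

text \<open>The definition compares only products with ordered indices. Commutativity sorts each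
  product, and the minimum and maximum of two indices determine them up to order.\<close>

lemma B2_sequence_cancel:
  assumes B: "B2_sequence G \<mu> a"
    and mem: "w \<in> a ` {1..\<mu>}" "x \<in> a ` {1..\<mu>}" "y \<in> a ` {1..\<mu>}" "z \<in> a ` {1..\<mu>}"
    and eq: "w \<otimes>\<^bsub>G\<^esub> x = y \<otimes>\<^bsub>G\<^esub> z"
  shows "w = y \<and> x = z \<or> w = z \<and> x = y"
proof -
  interpret comm_group G
    using B by (simp add: B2_sequence_def)
  obtain k l p q where idx: "k \<in> {1..\<mu>}" "l \<in> {1..\<mu>}" "p \<in> {1..\<mu>}" "q \<in> {1..\<mu>}"
    and val: "w = a k" "x = a l" "y = a p" "z = a q"
    using mem by blast
  have sort: "a i \<otimes>\<^bsub>G\<^esub> a j = a (min i j) \<otimes>\<^bsub>G\<^esub> a (max i j)" if "i \<in> {1..\<mu>}" "j \<in> {1..\<mu>}" for i j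
    using B that by (cases "i \<le> j") (auto simp: B2_sequence_def min_def max_def intro: m_comm)
  have "a (min k l) \<otimes>\<^bsub>G\<^esub> a (max k l) = a (min p q) \<otimes>\<^bsub>G\<^esub> a (max p q)"
    using eq idx by (simp only: val sort)
  moreover have "inj_on (\<lambda>(i, j). a i \<otimes>\<^bsub>G\<^esub> a j) {(i, j). 1 \<le> i \<and> i \<le> j \<and> j \<le> \<mu>}"
    using B by (simp add: B2_sequence_def)
  ultimately have "(min k l, max k l) = (min p q, max p q)"
    using idx by (elim inj_onD) auto
  then have "k = p \<and> l = q \<or> k = q \<and> l = p"
    by (auto simp: min_def max_def split: if_splits)
  then show ?thesis
    using val by blast
qed

lemma DDC_fold_array_lee_sphere:
  assumes n: "n \<ge> 2 * R\<^sup>2 + 2 * R + 1"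
    and B: "B2_sequence (integer_mod_group n) \<mu> a"
  shows "DDC (fold_array n R (a ` {1..\<mu>}) \<inter> lee_sphere c R)"
proof -
  let ?f = "\<lambda>(i, j). fold_map n R i j"
  let ?S = "fold_array n R (a ` {1..\<mu>}) \<inter> lee_sphere c R"
  have D: "?f p \<in> a ` {1..\<mu>}" if "p \<in> ?S" for p
    using that by (auto simp: fold_array_def)
  have inj: "p = q" if "p \<in> ?S" "q \<in> ?S" "?f p = ?f q" for p q
    using inj_onD[OF inj_on_fold_map_lee_sphere[OF n]] that by blast
  \<comment> \<open>\<open>f\<close> is a homomorphism from the grid to the integers modulo
    \<open>n\<close>, so this holds even when \<open>p + q\<close> leaves the sphere.\<close>
  have sum: "?f p \<otimes>\<^bsub>integer_mod_group n\<^esub> ?f q = ?f (p + q)" for p q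
  proof -
    obtain i j k l where pq: "p = (i, j)" "q = (k, l)"
      by (cases p, cases q)
    have "(i * int R + j * (int R + 1)) + (k * int R + l * (int R + 1))
        = (i + k) * int R + (j + l) * (int R + 1)"
      by (simp add: algebra_simps)
    then show ?thesis
      by (simp only: pq fold_map_def mult_integer_mod_group mod_add_eq prod.case add_Pair)
  qed
  have unique: "x = x' \<and> y = y'"
    if S: "x \<in> ?S" "y \<in> ?S" "x' \<in> ?S" "y' \<in> ?S" and "x \<noteq> y" and eq: "x - y = x' - y'" for x y x' y'
  proof -
    have "x + y' = x' + y"
      using eq by (metis add.commute add_diff_eq diff_eq_eq)
    then have "?f x \<otimes>\<^bsub>integer_mod_group n\<^esub> ?f y' = ?f x' \<otimes>\<^bsub>integer_mod_group n\<^esub> ?f y"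
      by (simp only: sum)
    \<comment> \<open>Cancellation offers two matchings. The one with \<open>?f x = ?f y\<close>
      contradicts \<open>x \<noteq> y\<close>, since \<open>f\<close> is injective on the
      sphere.\<close>
    from B2_sequence_cancel[OF B D D D D this] S
    have "?f x = ?f x' \<or> ?f x = ?f y"
      by blast
    with inj S \<open>x \<noteq> y\<close> have "x = x'"
      by metis
    with eq show ?thesis
      by simp
  qed
  show ?thesis
    unfolding DDC_def
  proof (rule inj_onI)
    fix P Q
    assume P: "P \<in> {(x, y). x \<in> ?S \<and> y \<in> ?S \<and> x \<noteq> y}"
      and Q: "Q \<in> {(x, y). x \<in> ?S \<and> y \<in> ?S \<and> x \<noteq> y}"
      and eq: "(\<lambda>(x, y). x - y) P = (\<lambda>(x, y). x - y) Q"
    obtain x y x' y' where PQ: "P = (x, y)" "Q = (x', y')"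
      by (cases P, cases Q)
    have "x = x' \<and> y = y'"
      by (rule unique) (use P Q eq in \<open>simp_all only: PQ mem_Collect_eq prod.case simp_thms\<close>)
    then show "P = Q"
      by (simp add: PQ)
  qed
qed

theorem theorem17:
  fixes r R n \<mu> :: nat and a :: "nat \<Rightarrow> int" and D :: "int set" and A :: "(int \<times> int) set"
  assumes "r > 0"
    and "R = r div 2"
    and "n \<ge> 2 * R\<^sup>2 + 2 * R + 1"
    and "B2_sequence (integer_mod_group n) \<mu> a"
    and "D = a ` {1..\<mu>}"
    and "A = fold_array n R D"
  shows "doubly_periodic A n n \<and>
    has_density A n n (real \<mu> / real n) \<and>
    (\<forall>c. DDC (A \<inter> lee_sphere c R))"
proof (intro conjI allI)
  show "doubly_periodic A n n"
    unfolding assms(6) by (rule doubly_periodic_fold_array)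
  have "n > 0"
    using assms(3) by simp
  moreover have "D \<subseteq> {0..<int n}"
  proof -
    \<comment> \<open>Positivity of \<open>n\<close> matters: for \<open>n = 0\<close> the carrier
      would be all integers.\<close>
    have "\<forall>i\<in>{1..\<mu>}. a i \<in> {0..<int n}"
      using assms(4) \<open>n > 0\<close> by (simp add: B2_sequence_def carrier_integer_mod_group)
    then show ?thesis
      unfolding assms(5) by blast
  qed
  moreover have "card D = \<mu>"
    using assms(4) card_image[of a "{1..\<mu>}"] by (simp add: assms(5) B2_sequence_def)
  ultimately show "has_density A n n (real \<mu> / real n)"
    using has_density_fold_array[of n D R] by (simp add: assms(6))
  show "DDC (A \<inter> lee_sphere c R)" for c
    using DDC_fold_array_lee_sphere[OF assms(3,4)] by (simp add: assms(5,6))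
qed

end
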